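(* Let $\mathcal{N}$ be a finite ground set of size $n$, $g\colon 2^{\mathcal{N}}\to\mathbb{R}_{\ge0}$ non-negative, monotone and $\gamma$-weakly submodular with $\gamma\in(0,1]$, $c$ a non-negative modular function, $k\ge1$ an integer, $\epsilon\in(0,1)$, and $\mathit{OPT}$ an optimal solution of $\max_{|S|\le k} g(S)-c(S)$. Then Stochastic Distorted Greedy (described in the context), run on $g,\gamma,c,k,\epsilon$, uses $O(n\log\frac1\epsilon)$ evaluations of $g$ and returns a set $R$ with \[ \mathbb{E}[g(R)-c(R)]\ \ge\ (1-e^{-\gamma}-\epsilon)\,g(\mathit{OPT})-c(\mathit{OPT}). \]
   Context: Notation: $g(e\mid S)=g(S\cup\{e\})-g(S)$; a monotone $g$ is $\gamma$-weakly submodular if $\sum_{e\in B\setminus A} g(e\mid A)\ge\gamma(g(A\cup B)-g(A))$ for all $A\subseteq B$; $c(S)=\sum_{e\in S}c_e$ with $c_e\ge 0$. $g$ is accessed via a value oracle. Stochastic Distorted Greedy: set $S_0=\varnothing$ and $s=\lceil \frac{n}{k}\log\frac1\epsilon\rceil$. For $i=0,\dots,k-1$: let $B_i$ consist of $s$ elements sampled uniformly and independently from $\mathcal{N}$; let $e_i\in\arg\max_{e\in B_i}\{(1-\gamma/k)^{k-(i+1)}g(e\mid S_i)-c_e\}$; if $(1-\gamma/k)^{k-(i+1)}g(e_i\mid S_i)-c_{e_i}>0$ then $S_{i+1}=S_i\cup\{e_i\}$, else $S_{i+1}=S_i$. Return $S_k$.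
   Formalization: The O(n log(1/ε)) evaluation bound is proved uniformly for k ≤ K·n and ε ≤ ε₀ < 1 (any constants K, ε₀); one constant for all k ≥ 1, ε in (0,1) is impossible because of the ceiling in s (n = k = 1, ε → 1). The expectation bound has no such restriction. *)

theory Defs
  imports "HOL-Probability.Probability" "HOL-Library.Landau_Symbols"
begin

section \<open>Set functions\<close>

definition marginal :: "('a set \<Rightarrow> real) \<Rightarrow> 'a \<Rightarrow> 'a set \<Rightarrow> real" where
  "marginal g e S = g (S \<union> {e}) - g S"

definition weakly_submodular :: "'a set \<Rightarrow> real \<Rightarrow> ('a set \<Rightarrow> real) \<Rightarrow> bool" where
  "weakly_submodular N \<gamma> g \<longleftrightarrow>
    (\<forall>A B. A \<subseteq> B \<longrightarrow> B \<subseteq> N \<longrightarrow>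
      (\<Sum>e\<in>B - A. marginal g e A) \<ge> \<gamma> * (g (A \<union> B) - g A))"

section \<open>Randomized algorithms with a value oracle\<close>

text \<open>
  An algorithm is a decision tree. It learns about the set function only through
  \<open>Query S\<close>, whose continuation receives the value of the function at \<open>S\<close>;
  \<open>run g\<close> answers the queries with \<open>g\<close> and yields the joint distribution of the
  result and of the number of queries made (repeated queries are counted every time).
\<close>

datatype ('a, 'r) oracle_alg =
    Return 'r
  | Query "'a set" "real \<Rightarrow> ('a, 'r) oracle_alg"
  | Sample "'a list pmf" "'a list \<Rightarrow> ('a, 'r) oracle_alg"

primrec bind_alg ::
  "('a, 'r) oracle_alg \<Rightarrow> ('r \<Rightarrow> ('a, 's) oracle_alg) \<Rightarrow> ('a, 's) oracle_alg" where
  "bind_alg (Return r) f = f r"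
| "bind_alg (Query S h) f = Query S (\<lambda>x. bind_alg (h x) f)"
| "bind_alg (Sample p h) f = Sample p (\<lambda>B. bind_alg (h B) f)"

primrec run :: "('a set \<Rightarrow> real) \<Rightarrow> ('a, 'r) oracle_alg \<Rightarrow> ('r \<times> nat) pmf" where
  "run g (Return r) = return_pmf (r, 0)"
| "run g (Query S h) = map_pmf (\<lambda>(r, q). (r, Suc q)) (run g (h (g S)))"
| "run g (Sample p h) = bind_pmf p (\<lambda>B. run g (h B))"

section \<open>Stochastic Distorted Greedy\<close>

text \<open>The marginal gains over \<open>S\<close> of the listed elements, as a function that is \<open>0\<close> elsewhere.\<close>

primrec query_marginals :: "'a set \<Rightarrow> 'a list \<Rightarrow> ('a, 'a \<Rightarrow> real) oracle_alg" where
  "query_marginals S [] = Return (\<lambda>_. 0)"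
| "query_marginals S (e # es) =
     Query (S \<union> {e}) (\<lambda>x. Query S (\<lambda>y.
       bind_alg (query_marginals S es) (\<lambda>w. Return (w(e := x - y)))))"

definition sample_size :: "nat \<Rightarrow> nat \<Rightarrow> real \<Rightarrow> nat" where
  "sample_size n k \<epsilon> = nat \<lceil>real n / real k * ln (1 / \<epsilon>)\<rceil>"

text \<open>
  \<open>tie i S B A\<close> is the maximizer picked from the set \<open>A\<close> of all maximizers, in iteration \<open>i\<close>
  with current solution \<open>S\<close> and sample \<open>B\<close>.
\<close>

definition valid_tie_breaking :: "(nat \<Rightarrow> 'a set \<Rightarrow> 'a list \<Rightarrow> 'a set \<Rightarrow> 'a) \<Rightarrow> bool" where
  "valid_tie_breaking tie \<longleftrightarrow> (\<forall>i S B A. A \<noteq> {} \<longrightarrow> tie i S B A \<in> A)"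

text \<open>
  \<open>sdg_iter \<dots> i\<close> computes \<open>S\<^sub>i\<close>. The sample is empty only if \<open>N\<close> is empty
  (for \<open>k \<ge> 1\<close> and \<open>0 < \<epsilon> < 1\<close>), in which case there is nothing to add.
\<close>

primrec sdg_iter ::
  "(nat \<Rightarrow> 'a set \<Rightarrow> 'a list \<Rightarrow> 'a set \<Rightarrow> 'a) \<Rightarrow> 'a set \<Rightarrow> real \<Rightarrow> ('a \<Rightarrow> real)
    \<Rightarrow> nat \<Rightarrow> real \<Rightarrow> nat \<Rightarrow> ('a, 'a set) oracle_alg" where
  "sdg_iter tie N \<gamma> c k \<epsilon> 0 = Return {}"
| "sdg_iter tie N \<gamma> c k \<epsilon> (Suc i) =
     bind_alg (sdg_iter tie N \<gamma> c k \<epsilon> i) (\<lambda>S.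
       Sample (replicate_pmf (sample_size (card N) k \<epsilon>) (pmf_of_set N)) (\<lambda>B.
         bind_alg (query_marginals S B) (\<lambda>w.
           let score = (\<lambda>e. (1 - \<gamma> / real k) ^ (k - (i + 1)) * w e - c e);
               e = tie i S B {e. is_arg_max score (\<lambda>e. e \<in> set B) e}
           in Return (if B \<noteq> [] \<and> score e > 0 then S \<union> {e} else S))))"

definition stochastic_distorted_greedy ::
  "(nat \<Rightarrow> 'a set \<Rightarrow> 'a list \<Rightarrow> 'a set \<Rightarrow> 'a) \<Rightarrow> 'a set \<Rightarrow> real \<Rightarrow> ('a \<Rightarrow> real)
    \<Rightarrow> nat \<Rightarrow> real \<Rightarrow> ('a, 'a set) oracle_alg" where
  "stochastic_distorted_greedy tie N \<gamma> c k \<epsilon> = sdg_iter tie N \<gamma> c k \<epsilon> k"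

end

theory Submission
  imports Defs
begin

text \<open>
  Put \<open>d i = (1 - \<gamma>/k) ^ (k - i)\<close>, so that \<open>d (i + 1) - d i = \<gamma>/k * d (i + 1)\<close>, and follow the
  potential \<open>d i * g S\<^sub>i - c S\<^sub>i\<close>. In iteration \<open>i\<close> it grows by \<open>\<gamma>/k * d (i + 1) * g S\<^sub>i\<close> plus the
  best positive score in the sample. The latter is at least the positive part of the score of the
  first sampled element of \<open>OPT\<close>, which is uniform on \<open>OPT\<close> and exists with probability at least
  \<open>(1 - \<epsilon>) * card OPT / k\<close>; by weak submodularity its expectation is therefore at least
  \<open>(1 - \<epsilon>) / k * (\<gamma> * d (i + 1) * (g OPT - g S\<^sub>i) - c OPT)\<close>. Summing over the iterations telescopes.
\<close>

section \<open>Finitely supported distributions and samples\<close>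

lemma expectation_bind_pmf_finite:
  fixes h :: "'b \<Rightarrow> real"
  assumes "finite (set_pmf p)" "\<And>x. x \<in> set_pmf p \<Longrightarrow> finite (set_pmf (f x))"
  shows "measure_pmf.expectation (bind_pmf p f) h =
    measure_pmf.expectation p (\<lambda>x. measure_pmf.expectation (f x) h)"
proof -
  have "measure_pmf.expectation (bind_pmf p f) h =
      (\<Sum>a\<in>set_pmf p. pmf p a *\<^sub>R measure_pmf.expectation (f a) h)"
    by (rule pmf_expectation_bind) (use assms in auto)
  also have "\<dots> = measure_pmf.expectation p (\<lambda>x. measure_pmf.expectation (f x) h)"
    by (subst integral_measure_pmf[of "set_pmf p"]) (use assms in auto)
  finally show ?thesis .
qed

lemma expectation_mono_finite:
  fixes f h :: "'b \<Rightarrow> real"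
  assumes "finite (set_pmf p)" "\<And>x. x \<in> set_pmf p \<Longrightarrow> f x \<le> h x"
  shows "measure_pmf.expectation p f \<le> measure_pmf.expectation p h"
  by (rule integral_mono_AE)
    (use assms in \<open>auto intro!: integrable_measure_pmf_finite simp: AE_measure_pmf_iff\<close>)

lemma finite_set_replicate_pmf:
  assumes "finite (set_pmf p)"
  shows "finite (set_pmf (replicate_pmf n p))"
proof -
  have "set_pmf (replicate_pmf n p) = {xs. set xs \<subseteq> set_pmf p \<and> length xs = n}"
    by (auto simp: set_replicate_pmf)
  then show ?thesis
    using finite_lists_length_eq[OF assms] by simp
qed

section \<open>Hitting a fixed subset when sampling with replacement\<close>

text \<open>A lower estimate for the maximum over a sample whose expectation, unlike that of the
  maximum, is linear in \<open>h\<close>. The default 0 for a sample that misses \<open>A\<close> is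
  harmless as long as the maximum being bounded is nonnegative.\<close>

primrec first_value :: "('a \<Rightarrow> real) \<Rightarrow> 'a set \<Rightarrow> 'a list \<Rightarrow> real" where
  "first_value h A [] = 0"
| "first_value h A (x # xs) = (if x \<in> A then h x else first_value h A xs)"

lemma first_value_cases: "first_value h A xs = 0 \<or> (\<exists>x\<in>set xs. first_value h A xs = h x)"
  by (induction xs) auto

text \<open>Condition on the first draw: it lands in \<open>A\<close>, or it misses and the
  remaining draws start afresh. The summand for \<open>j\<close> is the probability that the first
  \<open>j\<close> draws all miss \<open>A\<close>.\<close>

lemma expectation_first_value:
  assumes N: "finite N" "N \<noteq> {}" and A: "A \<subseteq> N"
  shows "measure_pmf.expectation (replicate_pmf s (pmf_of_set N)) (first_value h A) =
    sum h A / card N * (\<Sum>j<s. (1 - card A / card N) ^ j)"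
proof (induction s)
  case 0
  then show ?case by simp
next
  case (Suc s)
  let ?n = "real (card N)" and ?m = "real (card A)"
  let ?R = "replicate_pmf s (pmf_of_set N)"
  let ?E = "measure_pmf.expectation ?R (first_value h A)"
  have n: "?n > 0" using N by (simp add: card_gt_0_iff)
  have fin: "finite (set_pmf ?R)" using N by (intro finite_set_replicate_pmf) simp
  have "measure_pmf.expectation (replicate_pmf (Suc s) (pmf_of_set N)) (first_value h A) =
      (\<Sum>x\<in>N. measure_pmf.expectation (map_pmf (Cons x) ?R) (first_value h A) /\<^sub>R ?n)"
    using N fin
    by (simp add: map_pmf_def[symmetric] pmf_expectation_bind_pmf_of_set del: integral_map_pmf)
  also have "\<dots> = (\<Sum>x\<in>N. (if x \<in> A then h x else ?E) / ?n)"
    by (intro sum.cong) (auto simp: divide_inverse mult.commute)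
  also have "\<dots> = (sum h A + (?n - ?m) * ?E) / ?n"
  proof -
    have "(\<Sum>x\<in>N. if x \<in> A then h x else ?E) = sum h (N \<inter> A) + (\<Sum>x\<in>N \<inter> - A. ?E)"
      using N by (subst sum.If_cases) auto
    also have "N \<inter> A = A" using A by auto
    also have "(\<Sum>x\<in>N \<inter> - A. ?E) = (?n - ?m) * ?E"
      using card_Diff_subset[OF finite_subset[OF A N(1)] A] card_mono[OF N(1) A]
      by (simp add: Diff_eq[symmetric] of_nat_diff)
    finally show ?thesis by (simp add: sum_divide_distrib[symmetric])
  qed
  also have "\<dots> = sum h A / ?n + (1 - ?m / ?n) * ?E"
    using n by (simp add: field_simps)
  also have "\<dots> = sum h A / ?n * (1 + (1 - ?m / ?n) * (\<Sum>j<s. (1 - ?m / ?n) ^ j))"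
    by (simp only: Suc.IH) (simp only: distrib_left mult_1_right mult_ac)
  also have "1 + (1 - ?m / ?n) * (\<Sum>j<s. (1 - ?m / ?n) ^ j) = (\<Sum>j<Suc s. (1 - ?m / ?n) ^ j)"
    by (subst sum.lessThan_Suc_shift) (simp add: sum_distrib_left)
  finally show ?case .
qed

text \<open>Multiplied by \<open>m\<close>, the right-hand side is the probability that the sample
  hits a fixed set of \<open>m\<close> elements; leaving that factor out also covers
  \<open>m = 0\<close>. The sum shrinks as \<open>m\<close> grows, so for \<open>k \<le> n\<close>
  the worst case is \<open>m = k\<close>.\<close>

lemma sample_size_geometric_sum:
  assumes "0 < n" "m \<le> k" "m \<le> n" "1 \<le> k" "0 < \<epsilon>" "\<epsilon> < 1"
  shows "(1 - \<epsilon>) / k \<le> (\<Sum>j<sample_size n k \<epsilon>. (1 - m / n) ^ j) / n"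
proof -
  let ?s = "sample_size n k \<epsilon>"
  have arg: "real n / real k * ln (1 / \<epsilon>) > 0" using assms by simp
  then have s: "?s \<ge> 1" unfolding sample_size_def by linarith
  have s_ge: "real n / real k * ln (1 / \<epsilon>) \<le> ?s"
    unfolding sample_size_def by linarith
  have base: "0 \<le> 1 - m / real n" using assms by simp
  show ?thesis
  proof (cases "k \<le> n")
    case True
    let ?x = "1 - real k / n"
    have x: "0 \<le> ?x" using True assms by simp
    have "ln (1 / \<epsilon>) \<le> real ?s * (real k / n)"
      using s_ge assms by (simp add: field_simps)
    \<comment> \<open>By \<open>1 - t \<le> exp (- t)\<close> at \<open>t = k / n\<close>; the
      sample size is just large enough to push the probability of missing \<open>k\<close> elements
      down to \<open>\<epsilon>\<close>.\<close>
    have "?x ^ ?s \<le> exp (- (real k / n)) ^ ?s"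
      using exp_ge_add_one_self[of "- (real k / n)"] x by (intro power_mono) auto
    also have "\<dots> = exp (- (real ?s * (real k / n)))"
      by (simp add: exp_of_nat_mult[symmetric])
    also have "\<dots> \<le> exp (- ln (1 / \<epsilon>))"
      using \<open>ln (1 / \<epsilon>) \<le> real ?s * (real k / n)\<close> by simp
    also have "\<dots> = \<epsilon>" using assms by (simp add: ln_div)
    finally have "1 - \<epsilon> \<le> 1 - ?x ^ ?s" by simp
    also have "\<dots> = real k / n * (\<Sum>j<?s. ?x ^ j)"
      by (simp add: one_diff_power_eq)
    also have "\<dots> \<le> real k / n * (\<Sum>j<?s. (1 - m / n) ^ j)"
      using x assms by (intro mult_left_mono sum_mono power_mono) (auto simp: divide_right_mono)
    finally show ?thesis using assms by (simp add: field_simps)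
  next
    case False
    \<comment> \<open>Here \<open>1 - k / n\<close> is negative, so \<open>m\<close> cannot be
      replaced by \<open>k\<close>. The summand for \<open>j = 0\<close>, present because
      \<open>?s \<ge> 1\<close>, already contributes \<open>1 / n\<close>.\<close>
    have "(1 - \<epsilon>) / k \<le> 1 / k" using assms by (simp add: divide_right_mono)
    also have "\<dots> \<le> 1 / n" using False assms by (simp add: frac_le)
    also have "1 = (\<Sum>j<1. (1 - m / real n) ^ j)" by simp
    also have "\<dots> / n \<le> (\<Sum>j<?s. (1 - m / n) ^ j) / n"
      using s base by (intro divide_right_mono sum_mono2) auto
    finally show ?thesis by simp
  qed
qed

text \<open>\<open>M\<close> dominates \<open>first_value h A\<close> on every sample, because the
  latter is either 0 or the value of \<open>h\<close> at a sampled element. Its expectation carries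
  the geometric sum bounded above.\<close>

lemma expectation_sample_ge:
  fixes h :: "'a \<Rightarrow> real"
  assumes N: "finite N" and A: "A \<subseteq> N" "card A \<le> k"
    and "1 \<le> k" "0 < \<epsilon>" "\<epsilon> < 1"
    and h: "\<And>x. 0 \<le> h x"
    and M: "\<And>B. set B \<subseteq> N \<Longrightarrow> 0 \<le> M B" "\<And>B x. set B \<subseteq> N \<Longrightarrow> x \<in> set B \<Longrightarrow> h x \<le> M B"
  shows "(1 - \<epsilon>) / k * sum h A \<le>
    measure_pmf.expectation (replicate_pmf (sample_size (card N) k \<epsilon>) (pmf_of_set N)) M"
proof (cases "N = {}")
  case True
  \<comment> \<open>The sample size is 0 for empty \<open>N\<close>, so the sample is the empty list
    and nothing is drawn from \<open>pmf_of_set {}\<close>.\<close>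
  then show ?thesis using A M(1)[of "[]"] by (simp add: sample_size_def)
next
  case False
  let ?R = "replicate_pmf (sample_size (card N) k \<epsilon>) (pmf_of_set N)"
  have "(1 - \<epsilon>) / k * sum h A \<le>
      (\<Sum>j<sample_size (card N) k \<epsilon>. (1 - card A / card N) ^ j) / card N * sum h A"
    using assms False card_mono[OF N A(1)]
    by (intro mult_right_mono sample_size_geometric_sum sum_nonneg) (auto simp: card_gt_0_iff)
  also have "\<dots> = measure_pmf.expectation ?R (first_value h A)"
    using N False A(1) by (simp add: expectation_first_value)
  also have "\<dots> \<le> measure_pmf.expectation ?R M"
  proof (rule expectation_mono_finite)
    show "finite (set_pmf ?R)" using N False by (intro finite_set_replicate_pmf) simp
    fix B assume "B \<in> set_pmf ?R"
    then have "set B \<subseteq> N" using N False by (auto simp: set_replicate_pmf)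
    then show "first_value h A B \<le> M B"
      using first_value_cases[of h A B] M by auto
  qed
  finally show ?thesis .
qed

section \<open>Running the algorithm\<close>

lemma run_bind_alg:
  "run g (bind_alg a f) =
    bind_pmf (run g a) (\<lambda>(r, q). map_pmf (\<lambda>(r', q'). (r', q + q')) (run g (f r)))"
proof (induction a)
  case (Return r)
  then show ?case by (simp add: bind_return_pmf case_prod_unfold)
next
  case (Query S h)
  then show ?case
    by (simp add: map_bind_pmf bind_map_pmf case_prod_unfold map_pmf_comp)
next
  case (Sample p h)
  then show ?case by (simp add: bind_assoc_pmf)
qed

text \<open>The value 0 off the sample mirrors the function that \<open>query_marginals\<close>
  returns on the empty list, so that running it can be described by an equation of
  functions.\<close>

definition sampled_marginals :: "('a set \<Rightarrow> real) \<Rightarrow> 'a set \<Rightarrow> 'a list \<Rightarrow> 'a \<Rightarrow> real" where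
  "sampled_marginals g S B = (\<lambda>e. if e \<in> set B then marginal g e S else 0)"

lemma run_query_marginals:
  "run g (query_marginals S B) = return_pmf (sampled_marginals g S B, 2 * length B)"
proof (induction B)
  case Nil
  then show ?case by (simp add: sampled_marginals_def)
next
  case (Cons e B)
  \<comment> \<open>If \<open>e\<close> occurs again in \<open>B\<close>, the update overwrites its
    entry with the same marginal, so repetitions in the sample change nothing.\<close>
  have "(sampled_marginals g S B)(e := g (insert e S) - g S) = sampled_marginals g S (e # B)"
    by (auto simp: sampled_marginals_def marginal_def)
  with Cons show ?case by (simp add: run_bind_alg bind_return_pmf)
qed

locale sdg =
  fixes tie :: "nat \<Rightarrow> 'a set \<Rightarrow> 'a list \<Rightarrow> 'a set \<Rightarrow> 'a"
    and N :: "'a set" and g :: "'a set \<Rightarrow> real" and \<gamma> :: real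
    and c :: "'a \<Rightarrow> real" and k :: nat and \<epsilon> :: real
  assumes fin: "finite N"
    and g_nonneg: "\<And>S. S \<subseteq> N \<Longrightarrow> 0 \<le> g S"
    and g_mono: "mono_on (Pow N) g"
    and \<gamma>: "0 < \<gamma>" "\<gamma> \<le> 1"
    and weak: "weakly_submodular N \<gamma> g"
    and c_nonneg: "\<And>e. e \<in> N \<Longrightarrow> 0 \<le> c e"
    and k: "1 \<le> k"
    and \<epsilon>: "0 < \<epsilon>" "\<epsilon> < 1"
    and tie: "valid_tie_breaking tie"
begin

section \<open>One iteration as a function of the current solution and the sample\<close>

abbreviation "sample \<equiv> replicate_pmf (sample_size (card N) k \<epsilon>) (pmf_of_set N)"

abbreviation "iter i \<equiv> run g (sdg_iter tie N \<gamma> c k \<epsilon> i)"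

text \<open>Indexed so that iteration \<open>i\<close> scores with \<open>d (Suc i)\<close>, while
  \<open>d k = 1\<close> turns the final potential into the undistorted objective.\<close>

definition d :: "nat \<Rightarrow> real" where
  "d i = (1 - \<gamma> / real k) ^ (k - i)"

definition step :: "nat \<Rightarrow> 'a set \<Rightarrow> 'a list \<Rightarrow> 'a set" where
  "step i S B =
    (let score = (\<lambda>e. d (Suc i) * sampled_marginals g S B e - c e);
         e = tie i S B {e. is_arg_max score (\<lambda>e. e \<in> set B) e}
     in if B \<noteq> [] \<and> score e > 0 then S \<union> {e} else S)"

text \<open>Replaces the decision tree by a Markov chain on pairs of solution and query count; with
  the oracle answers filled in, the sample is the only randomness of an iteration.\<close>

lemma iter_Suc:
  "iter (Suc i) =
    bind_pmf (iter i) (\<lambda>(S, q). map_pmf (\<lambda>B. (step i S B, q + 2 * length B)) sample)"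
proof -
  have "run g (Sample sample (\<lambda>B. bind_alg (query_marginals S B) (\<lambda>w.
      let score = (\<lambda>e. (1 - \<gamma> / real k) ^ (k - (i + 1)) * w e - c e);
          e = tie i S B {e. is_arg_max score (\<lambda>e. e \<in> set B) e}
      in Return (if B \<noteq> [] \<and> score e > 0 then S \<union> {e} else S)))) =
    map_pmf (\<lambda>B. (step i S B, 2 * length B)) sample" for S
    by (simp add: run_bind_alg run_query_marginals bind_return_pmf Let_def step_def d_def map_pmf_def)
  then show ?thesis
    by (simp only: sdg_iter.simps run_bind_alg map_pmf_comp prod.case)
qed

lemma sample_set:
  assumes "B \<in> set_pmf sample"
  shows "set B \<subseteq> N" "length B = sample_size (card N) k \<epsilon>"
proof -
  show "length B = sample_size (card N) k \<epsilon>"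
    using assms by (simp add: set_replicate_pmf)
  show "set B \<subseteq> N"
  proof (cases "N = {}")
    case True
    then show ?thesis using assms by (simp add: sample_size_def)
  next
    case False
    then show ?thesis using assms fin by (auto simp: set_replicate_pmf)
  qed
qed

lemma finite_sample: "finite (set_pmf sample)"
  by (rule finite_subset[OF _ finite_lists_length_eq[OF fin]]) (use sample_set in auto)

text \<open>Removes the tie-breaking rule: a nonempty finite sample has a maximizer, so the rule
  returns one, and on sampled elements the queried marginals are the true ones.\<close>

lemma step_tie:
  assumes "B \<noteq> []"
  obtains e where "e \<in> set B"
    and "\<forall>e'\<in>set B. d (Suc i) * marginal g e' S - c e' \<le> d (Suc i) * marginal g e S - c e"
    and "step i S B = (if d (Suc i) * marginal g e S - c e > 0 then S \<union> {e} else S)"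
proof -
  define score where "score = (\<lambda>e. d (Suc i) * sampled_marginals g S B e - c e)"
  define A where "A = {e. is_arg_max score (\<lambda>e. e \<in> set B) e}"
  define e where "e = tie i S B A"
  have "\<exists>e\<in>set B. \<forall>e'\<in>set B. score e' \<le> score e"
    using assms Max_in[of "score ` set B"] Max_ge[of "score ` set B"]
    by (metis (no_types, lifting) List.finite_set empty_is_image finite_imageI image_iff set_empty)
  then have "A \<noteq> {}" by (auto simp: A_def is_arg_max_linorder)
  then have "e \<in> A" using tie by (auto simp: e_def valid_tie_breaking_def)
  then have e: "e \<in> set B" "\<And>e'. e' \<in> set B \<Longrightarrow> score e' \<le> score e"
    by (auto simp: A_def is_arg_max_linorder)
  have score: "score e' = d (Suc i) * marginal g e' S - c e'" if "e' \<in> set B" for e'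
    using that by (simp add: score_def sampled_marginals_def)
  have "step i S B = (if score e > 0 then S \<union> {e} else S)"
    using assms by (simp add: step_def Let_def score_def e_def A_def)
  with e score show thesis by (intro that[of e]) auto
qed

lemma step_subset:
  assumes "S \<subseteq> N" "set B \<subseteq> N"
  shows "step i S B \<subseteq> N"
proof (cases "B = []")
  case True
  then show ?thesis using assms by (simp add: step_def)
next
  case False
  then obtain e where "e \<in> set B" "step i S B \<subseteq> S \<union> {e}"
    by (rule step_tie[of B i S]) (auto split: if_splits)
  then show ?thesis using assms by auto
qed

text \<open>With the same factor \<open>d (Suc i)\<close> before and after, adding \<open>e\<close>
  changes the potential by exactly its score. If nothing is added, every sampled score is at most 0,
  which is then the gain.\<close>

lemma step_gain:
  fixes i :: nat
  assumes S: "S \<subseteq> N" and B: "set B \<subseteq> N"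
  defines "gain \<equiv> (d (Suc i) * g (step i S B) - sum c (step i S B)) - (d (Suc i) * g S - sum c S)"
  shows "0 \<le> gain" and "x \<in> set B \<Longrightarrow> d (Suc i) * marginal g x S - c x \<le> gain"
proof -
  have *: "0 \<le> gain \<and> (x \<in> set B \<longrightarrow> d (Suc i) * marginal g x S - c x \<le> gain)"
  proof (cases "B = []")
    case True
    then show ?thesis by (simp add: step_def gain_def)
  next
    case False
    then obtain e where e: "e \<in> set B"
      and max: "\<forall>e'\<in>set B.
        d (Suc i) * marginal g e' S - c e' \<le> d (Suc i) * marginal g e S - c e"
      and step: "step i S B = (if d (Suc i) * marginal g e S - c e > 0 then S \<union> {e} else S)"
      by (rule step_tie)
    show ?thesis
    proof (cases "d (Suc i) * marginal g e S - c e > 0")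
      case True
      \<comment> \<open>Needed for the cost to grow by exactly \<open>c e\<close>. An element
        already in \<open>S\<close> has score \<open>- c e \<le> 0\<close> and would not be
        selected.\<close>
      have "e \<notin> S"
      proof
        assume "e \<in> S"
        then have "marginal g e S = 0" by (simp add: marginal_def insert_absorb)
        then show False using True c_nonneg[of e] e B by auto
      qed
      then have "sum c (insert e S) = c e + sum c S"
        using finite_subset[OF S fin] by simp
      then have "gain = d (Suc i) * marginal g e S - c e"
        using True by (simp add: gain_def step marginal_def algebra_simps)
      then show ?thesis using True max by auto
    next
      case False
      then have "gain = 0" by (simp add: gain_def step)
      then show ?thesis using False max by auto
    qed
  qed
  then show "0 \<le> gain" "x \<in> set B \<Longrightarrow> d (Suc i) * marginal g x S - c x \<le> gain"
    by auto
qed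

section \<open>Expected growth of the potential in one iteration\<close>

lemma d_nonneg: "0 \<le> d i"
  using \<gamma> k by (simp add: d_def)

lemma d_Suc:
  assumes "i < k"
  shows "d i = (1 - \<gamma> / k) * d (Suc i)"
  using assms by (simp add: d_def Suc_diff_Suc[symmetric])

lemma d_0_le: "d 0 \<le> exp (- \<gamma>)"
  using exp_ge_one_minus_x_over_n_power_n[of \<gamma> k] \<gamma> k by (simp add: d_def)

text \<open>Weak submodularity for \<open>S\<close> inside \<open>S \<union> A\<close>: monotonicity
  compares \<open>g (S \<union> A)\<close> with \<open>g A\<close>, and elements of \<open>A\<close>
  already in \<open>S\<close> have marginal 0.\<close>

lemma sum_marginal_ge:
  assumes "S \<subseteq> N" "A \<subseteq> N"
  shows "\<gamma> * (g A - g S) \<le> (\<Sum>e\<in>A. marginal g e S)"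
proof -
  have "\<gamma> * (g A - g S) \<le> \<gamma> * (g (S \<union> A) - g S)"
    using g_mono assms \<gamma> by (auto simp: mono_on_def)
  also have "\<dots> \<le> (\<Sum>e\<in>(S \<union> A) - S. marginal g e S)"
  proof -
    have "\<gamma> * (g (S \<union> (S \<union> A)) - g S) \<le> (\<Sum>e\<in>(S \<union> A) - S. marginal g e S)"
      using weak assms unfolding weakly_submodular_def by blast
    then show ?thesis by (simp add: Un_assoc[symmetric])
  qed
  also have "\<dots> = (\<Sum>e\<in>A. marginal g e S)"
    using finite_subset[OF assms(2) fin]
    by (intro sum.mono_neutral_left) (auto simp: marginal_def insert_absorb)
  finally show ?thesis .
qed

lemma expectation_step:
  assumes S: "S \<subseteq> N" and A: "A \<subseteq> N" "card A \<le> k" and i: "i < k"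
  shows "d i * g S - sum c S + (1 - \<epsilon>) * (d (Suc i) - d i) * g A - sum c A / k
    \<le> measure_pmf.expectation sample (\<lambda>B. d (Suc i) * g (step i S B) - sum c (step i S B))"
proof -
  let ?\<Phi> = "\<lambda>S. d (Suc i) * g S - sum c S"
  \<comment> \<open>The positive part makes \<open>?h\<close> nonnegative, as the sampling bound
    requires; the gain of a step still dominates it, because that gain is itself
    nonnegative.\<close>
  let ?h = "\<lambda>e. max 0 (d (Suc i) * marginal g e S - c e)"
  have "(1 - \<epsilon>) / k * (d (Suc i) * (\<gamma> * (g A - g S)) - sum c A) \<le>
      (1 - \<epsilon>) / k * (d (Suc i) * (\<Sum>e\<in>A. marginal g e S) - sum c A)"
    using sum_marginal_ge[OF S A(1)] d_nonneg \<epsilon>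
    by (intro mult_left_mono diff_right_mono) auto
  also have "\<dots> = (1 - \<epsilon>) / k * (\<Sum>e\<in>A. d (Suc i) * marginal g e S - c e)"
    by (simp add: sum_subtractf sum_distrib_left)
  also have "\<dots> \<le> (1 - \<epsilon>) / k * sum ?h A"
    using \<epsilon> by (intro mult_left_mono sum_mono) auto
  also have "\<dots> \<le> measure_pmf.expectation sample (\<lambda>B. ?\<Phi> (step i S B) - ?\<Phi> S)"
    using step_gain[OF S] by (intro expectation_sample_ge fin A k \<epsilon>) auto
  also have "\<dots> = measure_pmf.expectation sample (\<lambda>B. ?\<Phi> (step i S B)) - ?\<Phi> S"
    by (subst Bochner_Integration.integral_diff)
      (auto intro!: integrable_measure_pmf_finite finite_sample)
  finally have main: "(1 - \<epsilon>) / k * (d (Suc i) * (\<gamma> * (g A - g S)) - sum c A) + ?\<Phi> S \<le>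
      measure_pmf.expectation sample (\<lambda>B. ?\<Phi> (step i S B))"
    by simp
  \<comment> \<open>This is the exact slack between \<open>main\<close> and the goal: the goal
    subtracts \<open>sum c A / k\<close> and \<open>\<gamma> / k * d (Suc i) * g S\<close> in full,
    whereas \<open>main\<close> subtracts only the fraction \<open>1 - \<epsilon>\<close> of
    each.\<close>
  have "0 \<le> \<epsilon> * (sum c A / k + \<gamma> / k * d (Suc i) * g S)"
    using A c_nonneg g_nonneg[OF S] d_nonneg \<gamma> \<epsilon>
    by (intro mult_nonneg_nonneg add_nonneg_nonneg divide_nonneg_nonneg sum_nonneg) auto
  also have "\<dots> = (1 - \<epsilon>) / k * (d (Suc i) * (\<gamma> * (g A - g S)) - sum c A) + ?\<Phi> S -
      (d i * g S - sum c S + (1 - \<epsilon>) * (d (Suc i) - d i) * g A - sum c A / k)"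
    using k by (simp add: d_Suc[OF i] field_simps)
  finally show ?thesis using main by linarith
qed

section \<open>Support of the iterates and the telescoped bound\<close>

text \<open>Finite support makes every function of the iterate integrable. The query count is
  deterministic, since each sampled element costs two queries whether or not anything is
  added.\<close>

lemma iter_support:
  "finite (set_pmf (iter i)) \<and>
    (\<forall>(S, q)\<in>set_pmf (iter i). S \<subseteq> N \<and> q = 2 * i * sample_size (card N) k \<epsilon>)"
proof (induction i)
  case 0
  then show ?case by simp
next
  case (Suc i)
  have "finite (set_pmf (iter (Suc i)))"
    using Suc finite_sample unfolding iter_Suc by (auto simp: case_prod_unfold)
  moreover have "S \<subseteq> N \<and> q = 2 * Suc i * sample_size (card N) k \<epsilon>"
    if Sq: "(S, q) \<in> set_pmf (iter (Suc i))" for S q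
  proof -
    from Sq obtain S' q' B where "(S', q') \<in> set_pmf (iter i)" "B \<in> set_pmf sample"
      and eq: "S = step i S' B" "q = q' + 2 * length B"
      unfolding iter_Suc by auto
    then have "S' \<subseteq> N" "q' = 2 * i * sample_size (card N) k \<epsilon>"
      "set B \<subseteq> N" "length B = sample_size (card N) k \<epsilon>"
      using Suc sample_set by blast+
    then show ?thesis using eq by (simp add: step_subset)
  qed
  ultimately show ?case by blast
qed

text \<open>The one-step bounds, averaged over the current solution, telescope in \<open>d\<close>
  and charge \<open>sum c A / k\<close> once per iteration.\<close>

lemma expectation_iter:
  assumes A: "A \<subseteq> N" "card A \<le> k" and "i \<le> k"
  shows "(1 - \<epsilon>) * (d i - d 0) * g A - i / k * sum c A
    \<le> measure_pmf.expectation (iter i) (\<lambda>(S, q). d i * g S - sum c S)"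
  using \<open>i \<le> k\<close>
proof (induction i)
  case 0
  \<comment> \<open>The initial potential is \<open>d 0 * g {}\<close>; nonnegativity of
    \<open>g\<close> suffices, without normalization at the empty set.\<close>
  then show ?case using d_nonneg g_nonneg[of "{}"] by simp
next
  case (Suc i)
  let ?\<delta> = "(1 - \<epsilon>) * (d (Suc i) - d i) * g A - sum c A / k"
  let ?\<Phi> = "\<lambda>(S, q). d i * g S - sum c S"
  have "(1 - \<epsilon>) * (d (Suc i) - d 0) * g A - Suc i / k * sum c A =
      (1 - \<epsilon>) * (d i - d 0) * g A - i / k * sum c A + ?\<delta>"
    by (simp add: algebra_simps add_divide_distrib)
  also have "\<dots> \<le> measure_pmf.expectation (iter i) ?\<Phi> + ?\<delta>"
    using Suc by simp
  also have "\<dots> = measure_pmf.expectation (iter i) (\<lambda>x. ?\<Phi> x + ?\<delta>)"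
    by (subst Bochner_Integration.integral_add)
      (use iter_support in \<open>auto intro!: integrable_measure_pmf_finite\<close>)
  also have "\<dots> \<le> measure_pmf.expectation (iter i) (\<lambda>(S, q).
      measure_pmf.expectation sample (\<lambda>B. d (Suc i) * g (step i S B) - sum c (step i S B)))"
  proof (rule expectation_mono_finite)
    show "finite (set_pmf (iter i))" using iter_support by blast
    fix x assume x: "x \<in> set_pmf (iter i)"
    obtain S q where "x = (S, q)" by (cases x)
    moreover have "S \<subseteq> N" using iter_support[of i] x calculation by blast
    ultimately show "?\<Phi> x + ?\<delta> \<le> (case x of (S, q) \<Rightarrow>
        measure_pmf.expectation sample (\<lambda>B. d (Suc i) * g (step i S B) - sum c (step i S B)))"
      using expectation_step[OF _ A, of S i] Suc.prems by simp
  qed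
  \<comment> \<open>Tower rule: averaging over the new sample and then over the old iterate gives
    the expectation over the new iterate.\<close>
  also have "\<dots> = measure_pmf.expectation (iter (Suc i)) (\<lambda>(S, q). d (Suc i) * g S - sum c S)"
    unfolding iter_Suc using iter_support[of i] finite_sample
    by (subst expectation_bind_pmf_finite) (auto simp: case_prod_unfold)
  finally show ?case .
qed

lemma expectation_guarantee:
  assumes A: "A \<subseteq> N" "card A \<le> k"
  shows "(1 - exp (- \<gamma>) - \<epsilon>) * g A - sum c A
    \<le> measure_pmf.expectation (iter k) (\<lambda>(S, q). g S - sum c S)"
proof -
  \<comment> \<open>The product exceeds the left-hand side by
    \<open>\<epsilon> * exp (- \<gamma>)\<close>.\<close>
  have "1 - exp (- \<gamma>) - \<epsilon> \<le> (1 - \<epsilon>) * (1 - exp (- \<gamma>))"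
    using \<epsilon> by (simp add: algebra_simps)
  also have "\<dots> \<le> (1 - \<epsilon>) * (1 - d 0)"
    using d_0_le \<epsilon> by (intro mult_left_mono) auto
  finally have "(1 - exp (- \<gamma>) - \<epsilon>) * g A \<le> (1 - \<epsilon>) * (1 - d 0) * g A"
    using g_nonneg[OF A(1)] by (intro mult_right_mono)
  moreover have "d k = 1" by (simp add: d_def)
  ultimately show ?thesis
    using expectation_iter[OF A, of k] k by simp
qed

end

section \<open>The number of queries\<close>

text \<open>Rounding up costs at most 1 per iteration, hence at most \<open>k\<close> before
  doubling. This is absorbed because \<open>k \<le> K * n\<close> and
  \<open>ln (1 / \<epsilon>)\<close> is at least the positive constant
  \<open>ln (1 / \<epsilon>\<^sub>0)\<close>.\<close>

lemma sample_size_bound: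
  assumes "1 \<le> k" "real k \<le> K * real n" "0 < \<epsilon>" "\<epsilon> \<le> \<epsilon>\<^sub>0" "\<epsilon>\<^sub>0 < 1"
  shows "real (2 * k * sample_size n k \<epsilon>) \<le>
    2 * (1 + K / ln (1 / \<epsilon>\<^sub>0)) * (real n * ln (1 / \<epsilon>))"
proof -
  have ln0: "0 < ln (1 / \<epsilon>\<^sub>0)" using assms by simp
  have ln: "ln (1 / \<epsilon>\<^sub>0) \<le> ln (1 / \<epsilon>)" using assms by (simp add: frac_le)
  have Kn: "0 \<le> K * real n" using assms by linarith
  have "real (sample_size n k \<epsilon>) \<le> real n / real k * ln (1 / \<epsilon>) + 1"
  proof -
    have "0 \<le> real n / real k * ln (1 / \<epsilon>)" using ln ln0 by simp
    then show ?thesis unfolding sample_size_def by linarith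
  qed
  then have "real k * real (sample_size n k \<epsilon>) \<le> real k * (real n / real k * ln (1 / \<epsilon>) + 1)"
    by (intro mult_left_mono) auto
  also have "\<dots> = real n * ln (1 / \<epsilon>) + real k"
    using assms by (simp add: field_simps)
  also have "\<dots> \<le> real n * ln (1 / \<epsilon>) + K * real n * (ln (1 / \<epsilon>) / ln (1 / \<epsilon>\<^sub>0))"
  proof -
    have "K * real n * 1 \<le> K * real n * (ln (1 / \<epsilon>) / ln (1 / \<epsilon>\<^sub>0))"
      using Kn ln ln0 by (intro mult_left_mono) auto
    then show ?thesis using assms by simp
  qed
  finally have "2 * (real k * real (sample_size n k \<epsilon>)) \<le>
      2 * (real n * ln (1 / \<epsilon>) + K * real n * (ln (1 / \<epsilon>) / ln (1 / \<epsilon>\<^sub>0)))"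
    by simp
  then show ?thesis by (simp add: algebra_simps)
qed

text \<open>For a principal filter, big-O asks for one constant valid at every point of the region,
  with no limit involved; this constant depends only on \<open>K\<close> and
  \<open>\<epsilon>\<^sub>0\<close>.\<close>

lemma query_count_bigo:
  assumes "\<epsilon>\<^sub>0 < 1"
  shows "(\<lambda>(n, k, \<epsilon>). real (2 * k * sample_size n k \<epsilon>)) \<in>
    O[principal {(n, k, \<epsilon>). 1 \<le> k \<and> real k \<le> K * real n \<and> 0 < \<epsilon> \<and> \<epsilon> \<le> \<epsilon>\<^sub>0}](
      \<lambda>(n, k, \<epsilon>). real n * ln (1 / \<epsilon>))"
proof (rule bigoI[where c = "2 * (1 + K / ln (1 / \<epsilon>\<^sub>0))"], unfold eventually_principal, safe)
  fix n k :: nat and \<epsilon> :: real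
  assume *: "1 \<le> k" "real k \<le> K * real n" "0 < \<epsilon>" "\<epsilon> \<le> \<epsilon>\<^sub>0"
  then have "0 \<le> real n * ln (1 / \<epsilon>)" using assms by simp
  then show "norm (real (2 * k * sample_size n k \<epsilon>))
      \<le> 2 * (1 + K / ln (1 / \<epsilon>\<^sub>0)) * norm (real n * ln (1 / \<epsilon>))"
    using sample_size_bound[OF * assms] by simp
qed

section \<open>Query complexity and approximation guarantee combined\<close>

theorem theorem2:
  "\<exists>T :: nat \<times> nat \<times> real \<Rightarrow> real.
     (\<forall>K \<epsilon>\<^sub>0. \<epsilon>\<^sub>0 < 1 \<longrightarrow>
        T \<in> O[principal {(n, k, \<epsilon>). 1 \<le> k \<and> real k \<le> K * real n \<and> 0 < \<epsilon> \<and> \<epsilon> \<le> \<epsilon>\<^sub>0}](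
              \<lambda>(n, k, \<epsilon>). real n * ln (1 / \<epsilon>))) \<and>
     (\<forall>(N :: 'a set) g \<gamma> c k \<epsilon> OPT tie.
        finite N \<longrightarrow>
        (\<forall>S\<subseteq>N. 0 \<le> g S) \<longrightarrow>
        mono_on (Pow N) g \<longrightarrow>
        0 < \<gamma> \<longrightarrow> \<gamma> \<le> 1 \<longrightarrow>
        weakly_submodular N \<gamma> g \<longrightarrow>
        (\<forall>e\<in>N. 0 \<le> c e) \<longrightarrow>
        1 \<le> k \<longrightarrow>
        0 < \<epsilon> \<longrightarrow> \<epsilon> < 1 \<longrightarrow>
        is_arg_max (\<lambda>S. g S - sum c S) (\<lambda>S. S \<subseteq> N \<and> card S \<le> k) OPT \<longrightarrow>
        valid_tie_breaking tie \<longrightarrow>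
        (let outcome = run g (stochastic_distorted_greedy tie N \<gamma> c k \<epsilon>) in
          (\<forall>(R, q) \<in> set_pmf outcome. real q \<le> T (card N, k, \<epsilon>)) \<and>
          measure_pmf.expectation outcome (\<lambda>(R, q). g R - sum c R)
            \<ge> (1 - exp (- \<gamma>) - \<epsilon>) * g OPT - sum c OPT))"
proof (intro exI conjI allI impI)
  \<comment> \<open>The witness is the exact count: \<open>k\<close> iterations, each with two
    queries for every sampled element.\<close>
  let ?T = "\<lambda>(n, k, \<epsilon>). real (2 * k * sample_size n k \<epsilon>)"
  show "?T \<in> O[principal {(n, k, \<epsilon>). 1 \<le> k \<and> real k \<le> K * real n \<and> 0 < \<epsilon> \<and> \<epsilon> \<le> \<epsilon>\<^sub>0}](
      \<lambda>(n, k, \<epsilon>). real n * ln (1 / \<epsilon>))" if "\<epsilon>\<^sub>0 < 1" for K \<epsilon>\<^sub>0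
    using that by (rule query_count_bigo)
next
  let ?T = "\<lambda>(n, k, \<epsilon>). real (2 * k * sample_size n k \<epsilon>)"
  fix N :: "'a set" and g c OPT and \<gamma> \<epsilon> :: real and k :: nat
    and tie :: "nat \<Rightarrow> 'a set \<Rightarrow> 'a list \<Rightarrow> 'a set \<Rightarrow> 'a"
  assume "finite N" "\<forall>S\<subseteq>N. 0 \<le> g S" "mono_on (Pow N) g" "0 < \<gamma>" "\<gamma> \<le> 1"
    "weakly_submodular N \<gamma> g" "\<forall>e\<in>N. 0 \<le> c e" "1 \<le> k" "0 < \<epsilon>" "\<epsilon> < 1"
    and OPT: "is_arg_max (\<lambda>S. g S - sum c S) (\<lambda>S. S \<subseteq> N \<and> card S \<le> k) OPT"
    and "valid_tie_breaking tie"
  then interpret sdg tie N g \<gamma> c k \<epsilon> by unfold_locales auto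
  show "let outcome = run g (stochastic_distorted_greedy tie N \<gamma> c k \<epsilon>) in
      (\<forall>(R, q) \<in> set_pmf outcome. real q \<le> ?T (card N, k, \<epsilon>)) \<and>
      measure_pmf.expectation outcome (\<lambda>(R, q). g R - sum c R)
        \<ge> (1 - exp (- \<gamma>) - \<epsilon>) * g OPT - sum c OPT"
    using iter_support[of k] expectation_guarantee[of OPT] OPT
    by (auto simp: stochastic_distorted_greedy_def is_arg_max_def)
qed

end
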